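(* Let $\alpha,\beta,\gamma$ be complex numbers such that $2\alpha+\beta+1$ and $2\beta+\alpha+1$ are not non-positive integers, and such that $\Re(2\alpha+2\beta-\gamma)>0$. Then $$ {}_3F_2\!\left[\begin{matrix}\alpha+1,\ \beta+1,\ \gamma\\ 2\alpha+\beta+1,\ 2\beta+\alpha+1\end{matrix};1\right]=\frac{2(\alpha+\beta)}{2(\alpha+\beta)-\gamma}\;{}_3F_2\!\left[\begin{matrix}\alpha,\ \beta,\ \gamma\\ 2\alpha+\beta+1,\ 2\beta+\alpha+1\end{matrix};1\right]. $$
   Context: For complex $a,b,c$ and complex $d,e$ that are not non-positive integers, ${}_3F_2\!\left[\begin{matrix}a,b,c\\ d,e\end{matrix};1\right]=\sum_{k=0}^{\infty}\frac{(a)_k(b)_k(c)_k}{k!\,(d)_k(e)_k}$, where $(x)_0=1$ and $(x)_k=x(x+1)\cdots(x+k-1)$ for $k\ge1$; the series converges when $\Re(d+e)>\Re(a+b+c)$. *)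

theory Defs
  imports Complex_Main "HOL-Library.Nonpos_Ints"
begin

text \<open>
  The generalized hypergeometric series 3F2 at unit argument, with upper parameters
  a, b, c and lower parameters d, e. Where d or e is a non-positive integer or the series
  diverges, the value carries no meaning; Re (d + e) > Re (a + b + c) ensures convergence.
\<close>
definition hypergeo_3F2_1 ::
    "complex \<Rightarrow> complex \<Rightarrow> complex \<Rightarrow> complex \<Rightarrow> complex \<Rightarrow> complex" where
  "hypergeo_3F2_1 a b c d e =
     (\<Sum>k. (pochhammer a k * pochhammer b k * pochhammer c k) /
          (fact k * pochhammer d k * pochhammer e k))"

end

theory Submission
  imports Defs "HOL-Analysis.Analysis"
begin

text \<open>
  Let \<open>t k\<close> and \<open>v k\<close> be the terms of the left and right series and \<open>s = \<alpha> + \<beta>\<close>.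
  Gosper's algorithm yields the telescoping relation
  \<open>(2 * s - \<gamma>) * t k - 2 * s * v k = G (k + 1) - G k\<close> with \<open>G 0 = 0\<close> and
  \<open>G (k + 1) = - (\<gamma> + k) * t k\<close>; the latter is \<open>- \<gamma>\<close> times the term \<open>t k\<close> with
  \<open>\<gamma> + 1\<close> in place of \<open>\<gamma>\<close>. Since \<open>t k\<close> decays like
  \<open>k powr (\<gamma> - 2 * s - 1)\<close>, both series converge and \<open>G\<close> tends to \<open>0\<close>.
\<close>

definition hypergeo_3F2_term ::
    "complex \<Rightarrow> complex \<Rightarrow> complex \<Rightarrow> complex \<Rightarrow> complex \<Rightarrow> nat \<Rightarrow> complex" where
  "hypergeo_3F2_term a b c d e k =
     (pochhammer a k * pochhammer b k * pochhammer c k) /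
     (fact k * pochhammer d k * pochhammer e k)"

text \<open>The factor \<open>rGamma_series z n\<close> converges to \<open>rGamma z\<close>, so the
  growth of the Pochhammer symbol is isolated in n! n^z.\<close>

lemma pochhammer_Suc_eq_rGamma_series:
  fixes z :: complex
  shows "pochhammer z (Suc n) = rGamma_series z n * fact n * exp (of_real (ln (of_nat n)) * z)"
  by (simp add: rGamma_series_def mult.commute)

text \<open>With k! read as (1)_k there are three Pochhammer symbols above and three below: the
  factorials cancel and the powers of n combine. The remaining quotient \<open>R\<close> of
  \<open>rGamma_series\<close> values converges, because \<open>rGamma\<close> vanishes only at
  non-positive integers, and is therefore bounded.\<close>

lemma hypergeo_3F2_term_Suc_bound:
  assumes "d \<notin> \<int>\<^sub>\<le>\<^sub>0" "e \<notin> \<int>\<^sub>\<le>\<^sub>0"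
  obtains K where "\<And>n. norm (hypergeo_3F2_term a b c d e (Suc n)) \<le>
    K * norm (exp (of_real (ln (of_nat n)) * (a + b + c - d - e - 1)))"
proof -
  define R where "R n = (rGamma_series a n * rGamma_series b n * rGamma_series c n) /
    (rGamma_series 1 n * rGamma_series d n * rGamma_series e n)" for n
  have eq: "hypergeo_3F2_term a b c d e (Suc n) =
      R n * exp (of_real (ln (of_nat n)) * (a + b + c - d - e - 1))" for n
  proof -
    define L where "L = complex_of_real (ln (of_nat n))"
    have fact: "fact (Suc n) = rGamma_series 1 n * fact n * exp L"
      using pochhammer_Suc_eq_rGamma_series[of 1 n]
      by (simp add: L_def pochhammer_fact[symmetric] del: fact_Suc)
    show ?thesis
      unfolding hypergeo_3F2_term_def R_def fact pochhammer_Suc_eq_rGamma_series L_def[symmetric]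
      by (simp add: ring_distribs exp_add exp_diff mult_ac)
  qed
  have "(1 :: complex) \<notin> \<int>\<^sub>\<le>\<^sub>0"
    by (auto elim!: nonpos_Ints_cases simp: complex_eq_iff)
  hence "R \<longlonglongrightarrow> (rGamma a * rGamma b * rGamma c) / (rGamma 1 * rGamma d * rGamma e)"
    unfolding R_def using assms
    by (intro tendsto_intros) (auto simp: rGamma_eq_zero_iff)
  hence "Bseq R"
    by (intro convergent_imp_Bseq convergentI)
  then obtain K where K: "\<And>n. norm (R n) \<le> K"
    by (auto simp: Bseq_def)
  show ?thesis
    by (rule that[of K]) (auto simp: eq norm_mult intro!: mult_right_mono K)
qed

lemma summable_hypergeo_3F2_term:
  assumes "d \<notin> \<int>\<^sub>\<le>\<^sub>0" "e \<notin> \<int>\<^sub>\<le>\<^sub>0" "Re (a + b + c) < Re (d + e)"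
  shows "summable (hypergeo_3F2_term a b c d e)"
proof -
  obtain K where K: "\<And>n. norm (hypergeo_3F2_term a b c d e (Suc n)) \<le>
      K * norm (exp (of_real (ln (of_nat n)) * (a + b + c - d - e - 1)))"
    using hypergeo_3F2_term_Suc_bound[OF assms(1,2)] by metis
  \<comment> \<open>The hypothesis puts the real part of the exponent below -1.\<close>
  have "summable (\<lambda>n. K * norm (exp (of_real (ln (of_nat n)) * (a + b + c - d - e - 1))))"
    using assms(3) by (intro summable_mult) (simp only: abs_summable_complex_powr_iff, simp)
  hence "summable (\<lambda>n. hypergeo_3F2_term a b c d e (Suc n))"
    by (rule summable_comparison_test') (rule K)
  thus ?thesis
    by (simp add: summable_Suc_iff)
qed

text \<open>Decay needs only an exponent with negative real part, one unit less than summability.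
  The telescoping boundary term, with \<gamma> + 1 in place of \<gamma>, uses this slack.\<close>

lemma hypergeo_3F2_term_tendsto_0:
  assumes "d \<notin> \<int>\<^sub>\<le>\<^sub>0" "e \<notin> \<int>\<^sub>\<le>\<^sub>0" "Re (a + b + c) < Re (d + e) + 1"
  shows "hypergeo_3F2_term a b c d e \<longlonglongrightarrow> 0"
proof -
  define s where "s = a + b + c - d - e - 1"
  obtain K where K: "\<And>n. norm (hypergeo_3F2_term a b c d e (Suc n)) \<le>
      K * norm (exp (of_real (ln (of_nat n)) * s))"
    unfolding s_def using hypergeo_3F2_term_Suc_bound[OF assms(1,2)] by metis
  have "Re s < 0"
    using assms(3) by (simp add: s_def)
  hence "(\<lambda>n. exp (Re s * ln (real n))) \<longlonglongrightarrow> 0"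
    by (intro filterlim_compose[OF exp_at_bot] filterlim_tendsto_neg_mult_at_bot[OF tendsto_const]
       filterlim_compose[OF ln_at_top] filterlim_real_sequentially)
  hence "(\<lambda>n. K * norm (exp (of_real (ln (of_nat n)) * s))) \<longlonglongrightarrow> 0"
    by (intro tendsto_mult_right_zero) (simp add: mult.commute)
  hence "(\<lambda>n. hypergeo_3F2_term a b c d e (Suc n)) \<longlonglongrightarrow> 0"
    by (rule Lim_null_comparison[OF always_eventually[rule_format, OF K]])
  thus ?thesis
    by (simp add: filterlim_sequentially_Suc)
qed

lemma hypergeo_3F2_term_telescope:
  fixes \<alpha> \<beta> \<gamma> :: complex
  defines "d \<equiv> 2 * \<alpha> + \<beta> + 1" and "e \<equiv> 2 * \<beta> + \<alpha> + 1"
  assumes "d \<notin> \<int>\<^sub>\<le>\<^sub>0" "e \<notin> \<int>\<^sub>\<le>\<^sub>0"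
  defines "G \<equiv> (\<lambda>k. case k of 0 \<Rightarrow> 0 |
    Suc m \<Rightarrow> - \<gamma> * hypergeo_3F2_term (\<alpha> + 1) (\<beta> + 1) (\<gamma> + 1) d e m)"
  shows "G (Suc k) - G k =
    (2 * (\<alpha> + \<beta>) - \<gamma>) * hypergeo_3F2_term (\<alpha> + 1) (\<beta> + 1) \<gamma> d e k -
    2 * (\<alpha> + \<beta>) * hypergeo_3F2_term \<alpha> \<beta> \<gamma> d e k"
proof (cases k)
  \<comment> \<open>Both terms equal 1 here, and \<open>G 1\<close> is -\<gamma>.\<close>
  case 0
  thus ?thesis by (simp add: G_def hypergeo_3F2_term_def)
next
  case (Suc m)
  have nz: "pochhammer d n \<noteq> 0" "pochhammer e n \<noteq> 0" for n
    using assms(3,4) by (auto dest: pochhammer_eq_0_imp_nonpos_Int)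
  define P Q where "P = pochhammer (\<alpha> + 1) m" and "Q = pochhammer (\<beta> + 1) m"
  define S where "S = pochhammer (\<gamma> + 1) m"
  define x D E where "x = (of_nat (Suc m) :: complex)"
    and "D = pochhammer d m" and "E = pochhammer e m"
  have x: "x \<noteq> 0" "1 + of_nat m = x" "of_nat m = x - 1"
    by (simp_all add: x_def del: of_nat_Suc) simp_all
  have DE: "D \<noteq> 0" "E \<noteq> 0" "d + x - 1 \<noteq> 0" "e + x - 1 \<noteq> 0"
    using nz[of m] nz[of "Suc m"] by (auto simp: D_def E_def pochhammer_Suc x add_diff_eq)
  \<comment> \<open>\<open>U\<close> is the term \<open>v k\<close> with its factor \<alpha>\<beta>
    removed, written without dividing by it so that \<alpha> = 0 or \<beta> = 0 is allowed. All four
    quantities are polynomials in \<open>x\<close> = k times \<open>U\<close>.\<close>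
  define U where "U = \<gamma> * P * Q * S / (x * fact m * (D * (d + x - 1)) * (E * (e + x - 1)))"
  have t: "hypergeo_3F2_term (\<alpha> + 1) (\<beta> + 1) \<gamma> d e k = (\<alpha> + x) * (\<beta> + x) * U"
    unfolding Suc hypergeo_3F2_term_def U_def pochhammer_rec[of \<gamma>]
    by (simp add: pochhammer_Suc P_def Q_def S_def D_def E_def x add_diff_eq mult_ac)
  have v: "hypergeo_3F2_term \<alpha> \<beta> \<gamma> d e k = \<alpha> * \<beta> * U"
    unfolding Suc hypergeo_3F2_term_def U_def pochhammer_rec[of \<alpha>] pochhammer_rec[of \<beta>]
      pochhammer_rec[of \<gamma>]
    by (simp add: pochhammer_Suc P_def Q_def S_def D_def E_def x add_diff_eq mult_ac)
  have G1: "G (Suc k) = - ((\<alpha> + x) * (\<beta> + x) * (\<gamma> + x) * U)"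
    unfolding Suc G_def hypergeo_3F2_term_def U_def
    by (simp add: pochhammer_Suc P_def Q_def S_def D_def E_def x add_diff_eq mult_ac)
  \<comment> \<open>\<open>G k\<close> involves the term of index m = k - 1, so the last factors k,
    d + m and e + m in the denominator of \<open>U\<close> must be cancelled.\<close>
  have G0: "G k = - (x * (d + x - 1) * (e + x - 1) * U)"
    using x(1) DE
    unfolding Suc G_def hypergeo_3F2_term_def U_def
    by (simp add: P_def Q_def S_def D_def E_def divide_simps)
  \<comment> \<open>As d - 1 = 2\<alpha> + \<beta> and e - 1 = 2\<beta> + \<alpha>, the coefficients
    of \<open>U\<close> agree: the cubes of \<open>x\<close> cancel and a quadratic identity
    remains.\<close>
  show ?thesis
    unfolding t v G0 G1 unfolding d_def e_def by (simp add: algebra_simps)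
qed

theorem theorem1:
  fixes \<alpha> \<beta> \<gamma> :: complex
  assumes "2 * \<alpha> + \<beta> + 1 \<notin> \<int>\<^sub>\<le>\<^sub>0"
    and "2 * \<beta> + \<alpha> + 1 \<notin> \<int>\<^sub>\<le>\<^sub>0"
    and "Re (2 * \<alpha> + 2 * \<beta> - \<gamma>) > 0"
  shows "hypergeo_3F2_1 (\<alpha> + 1) (\<beta> + 1) \<gamma> (2 * \<alpha> + \<beta> + 1) (2 * \<beta> + \<alpha> + 1) =
         2 * (\<alpha> + \<beta>) / (2 * (\<alpha> + \<beta>) - \<gamma>) *
         hypergeo_3F2_1 \<alpha> \<beta> \<gamma> (2 * \<alpha> + \<beta> + 1) (2 * \<beta> + \<alpha> + 1)"
proof -
  define d e where "d = 2 * \<alpha> + \<beta> + 1" and "e = 2 * \<beta> + \<alpha> + 1"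
  have de: "d \<notin> \<int>\<^sub>\<le>\<^sub>0" "e \<notin> \<int>\<^sub>\<le>\<^sub>0"
    using assms(1,2) by (simp_all add: d_def e_def)
  let ?t = "hypergeo_3F2_term (\<alpha> + 1) (\<beta> + 1) \<gamma> d e"
  let ?v = "hypergeo_3F2_term \<alpha> \<beta> \<gamma> d e"
  define G where "G = (\<lambda>k. case k of 0 \<Rightarrow> 0 |
    Suc m \<Rightarrow> - \<gamma> * hypergeo_3F2_term (\<alpha> + 1) (\<beta> + 1) (\<gamma> + 1) d e m)"
  have nz: "2 * (\<alpha> + \<beta>) - \<gamma> \<noteq> 0"
    using assms(3) by (auto simp: complex_eq_iff)
  \<comment> \<open>The excess of lower over upper parameters is
    \<open>2 * (\<alpha> + \<beta>) - \<gamma>\<close> for \<open>?t\<close> and larger by 2 for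
    \<open>?v\<close>.\<close>
  have sums: "summable ?t" "summable ?v"
    using assms(3) by (intro summable_hypergeo_3F2_term de; simp add: d_def e_def)+
  \<comment> \<open>Here the excess is \<open>2 * (\<alpha> + \<beta>) - \<gamma> - 1\<close>, whose
    real part exceeds -1: enough for a null sequence, though the series may diverge.\<close>
  have "hypergeo_3F2_term (\<alpha> + 1) (\<beta> + 1) (\<gamma> + 1) d e \<longlonglongrightarrow> 0"
    using assms(3) by (intro hypergeo_3F2_term_tendsto_0 de) (simp add: d_def e_def)
  hence "(\<lambda>k. G (Suc k)) \<longlonglongrightarrow> 0"
    unfolding G_def nat.case by (rule tendsto_mult_right_zero)
  hence "G \<longlonglongrightarrow> 0"
    by (simp add: filterlim_sequentially_Suc)
  hence "(\<lambda>k. G (Suc k) - G k) sums 0"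
    using telescope_sums[of G 0] by (simp add: G_def)
  moreover have "G (Suc k) - G k = (2 * (\<alpha> + \<beta>) - \<gamma>) * ?t k - 2 * (\<alpha> + \<beta>) * ?v k" for k
    unfolding G_def d_def e_def by (rule hypergeo_3F2_term_telescope[OF assms(1,2)])
  ultimately have "(\<lambda>k. (2 * (\<alpha> + \<beta>) - \<gamma>) * ?t k - 2 * (\<alpha> + \<beta>) * ?v k) sums 0"
    by simp
  moreover have "(\<lambda>k. (2 * (\<alpha> + \<beta>) - \<gamma>) * ?t k - 2 * (\<alpha> + \<beta>) * ?v k) sums
      ((2 * (\<alpha> + \<beta>) - \<gamma>) * suminf ?t - 2 * (\<alpha> + \<beta>) * suminf ?v)"
    by (intro sums_diff sums_mult summable_sums sums)
  ultimately have "(2 * (\<alpha> + \<beta>) - \<gamma>) * suminf ?t = 2 * (\<alpha> + \<beta>) * suminf ?v"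
    using sums_unique2 by fastforce
  hence "suminf ?t = 2 * (\<alpha> + \<beta>) / (2 * (\<alpha> + \<beta>) - \<gamma>) * suminf ?v"
    using nz by (simp add: field_simps)
  thus ?thesis
    by (simp add: hypergeo_3F2_1_def hypergeo_3F2_term_def[abs_def] d_def e_def)
qed

end
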